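(* Let $\mathcal{H}$ be a real Hilbert space, $A:\mathcal{H}\to\mathcal{H}$ a single-valued operator and $B:\mathcal{H}\rightrightarrows\mathcal{H}$ a set-valued operator such that the solution set $S:=\{x\in\mathcal{H}: 0\in A(x)+B(x)\}$ is nonempty. Let $v:\mathcal{H}\to\mathcal{H}$ be a mapping such that the pairs $(A,v)$ and $(B,v)$ are monotone, and let $\gamma>0$ be such that $\operatorname{ran}(\gamma B+v)=\mathcal{H}$. Let $x^*\in S$ and let $(x_k)_{k\ge 0}$ be any sequence with $x_0\in\mathcal{H}$ and $$x_{k+1}\in(\gamma B+v)^{-1}\bigl(v(x_k)-\gamma A(x_k)\bigr),\qquad k\ge 0.$$ (a) If $(A,v)$ is $\alpha$-cocoercive for some $\alpha>0$ and $\gamma<2\alpha$, then $(A(x_k))$ converges (in norm) to $A(x^* )$. Moreover, if $A^{-1}$ is single-valued and continuous, then $(x_k)$ converges (in norm) to $x^*$. (b) If $(v,A)$ is $\alpha$-cocoercive for some $\alpha>0$, $(A,v)$ is $L$-Lipschitz continuous for some $L>0$, and $\gamma<2\alpha/L^2$, then $(v(x_k))$ converges linearly to $v(x^* )$. Moreover, if $v^{-1}$ is single-valued and Lipschitz continuous, then $(x_k)$ converges linearly to $x^*$.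
   Context: For a set-valued operator $F:\mathcal{H}\rightrightarrows\mathcal{H}$: $\operatorname{ran}F=\bigcup_{x\in\mathcal{H}}F(x)$ and $F^{-1}(y)=\{x\in\mathcal{H}: y\in F(x)\}$. A single-valued map is identified with the set-valued operator taking singleton values. A pair $(F_1,F_2)$ of operators $F_1,F_2:\mathcal{H}\rightrightarrows\mathcal{H}$ is monotone if $\langle x_1^*-y_1^*,x_2^*-y_2^*\rangle\ge 0$ for all $x,y\in\mathcal{H}$, $x_1^*\in F_1(x)$, $y_1^*\in F_1(y)$, $x_2^*\in F_2(x)$, $y_2^*\in F_2(y)$. For single-valued $F_1,F_2:\mathcal{H}\to\mathcal{H}$, the pair $(F_1,F_2)$ is $\alpha$-cocoercive if $\langle F_1(x)-F_1(y),F_2(x)-F_2(y)\rangle\ge\alpha\|F_1(x)-F_1(y)\|^2$ for all $x,y\in\mathcal{H}$ (the order of the pair matters: the norm on the right involves the first entry), and it is $L$-Lipschitz continuous if $\|F_1(x)-F_1(y)\|\le L\|F_2(x)-F_2(y)\|$ for all $x,y\in\mathcal{H}$. The inverses $A^{-1}$ and $v^{-1}$, when single-valued, are regarded as maps $\operatorname{ran}A\to\mathcal{H}$ and $\operatorname{ran}v\to\mathcal{H}$. A sequence $(z_k)$ converges linearly to $z$ if there are $C\ge 0$ and $q\in[0,1)$ such that $\|z_k-z\|\le Cq^k$ for all $k\ge 0$. *)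

theory Defs
  imports "HOL-Analysis.Analysis"
begin

type_synonym 'a set_op = "'a \<Rightarrow> 'a set"

text \<open>Identification of a single-valued map with a set-valued operator.\<close>

definition op_of :: "('a \<Rightarrow> 'a) \<Rightarrow> 'a set_op" where
  "op_of f x = {f x}"

definition op_ran :: "'a set_op \<Rightarrow> 'a set" where
  "op_ran F = (\<Union>x. F x)"

definition op_inv :: "'a set_op \<Rightarrow> 'a set_op" where
  "op_inv F y = {x. y \<in> F x}"

definition op_add :: "'a::plus set_op \<Rightarrow> 'a set_op \<Rightarrow> 'a set_op" where
  "op_add F G x = {u + w | u w. u \<in> F x \<and> w \<in> G x}"

definition op_scale :: "real \<Rightarrow> 'a::real_vector set_op \<Rightarrow> 'a set_op" where
  "op_scale c F x = {c *\<^sub>R u | u. u \<in> F x}"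

definition op_zeros :: "'a::zero set_op \<Rightarrow> 'a set" where
  "op_zeros F = {x. 0 \<in> F x}"

definition single_valued_op_on :: "'a set \<Rightarrow> 'a set_op \<Rightarrow> bool" where
  "single_valued_op_on D F \<longleftrightarrow> (\<forall>y\<in>D. \<exists>x. F y = {x})"

text \<open>The map underlying a single-valued operator; its value at \<open>y\<close> is meaningful only
  if \<open>F y\<close> is a singleton, so it is to be used only on a set \<open>D\<close> with
  \<open>single_valued_op_on D F\<close>.\<close>

definition map_of_op :: "'a set_op \<Rightarrow> 'a \<Rightarrow> 'a" where
  "map_of_op F y = the_elem (F y)"

definition monotone_pair :: "'a::real_inner set_op \<Rightarrow> 'a set_op \<Rightarrow> bool" where
  "monotone_pair F1 F2 \<longleftrightarrow>
    (\<forall>x y. \<forall>x1\<in>F1 x. \<forall>y1\<in>F1 y. \<forall>x2\<in>F2 x. \<forall>y2\<in>F2 y.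
      inner (x1 - y1) (x2 - y2) \<ge> 0)"

definition cocoercive_pair :: "real \<Rightarrow> ('a::real_inner \<Rightarrow> 'a) \<Rightarrow> ('a \<Rightarrow> 'a) \<Rightarrow> bool" where
  "cocoercive_pair \<alpha> F1 F2 \<longleftrightarrow>
    (\<forall>x y. inner (F1 x - F1 y) (F2 x - F2 y) \<ge> \<alpha> * (norm (F1 x - F1 y))\<^sup>2)"

definition lipschitz_pair :: "real \<Rightarrow> ('a::real_inner \<Rightarrow> 'a) \<Rightarrow> ('a \<Rightarrow> 'a) \<Rightarrow> bool" where
  "lipschitz_pair L F1 F2 \<longleftrightarrow>
    (\<forall>x y. norm (F1 x - F1 y) \<le> L * norm (F2 x - F2 y))"

definition converges_linearly :: "(nat \<Rightarrow> 'a::real_normed_vector) \<Rightarrow> 'a \<Rightarrow> bool" where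
  "converges_linearly z l \<longleftrightarrow>
    (\<exists>C\<ge>0. \<exists>q. 0 \<le> q \<and> q < 1 \<and> (\<forall>k. norm (z k - l) \<le> C * q ^ k))"

end

theory Submission
  imports Defs
begin

text \<open>Writing \<open>V\<^sub>k = v x\<^sub>k - v x\<^sup>*\<close> and \<open>a\<^sub>k = A x\<^sub>k - A x\<^sup>*\<close>, monotonicity of \<open>(B, v)\<close> between
  \<open>x\<^sub>k\<^sub>+\<^sub>1\<close> and \<open>x\<^sup>*\<close> says that \<open>V\<^sub>k\<^sub>+\<^sub>1\<close> has nonnegative inner product with
  \<open>(V\<^sub>k - \<gamma> a\<^sub>k) - V\<^sub>k\<^sub>+\<^sub>1\<close>, so \<open>\<parallel>V\<^sub>k\<^sub>+\<^sub>1\<parallel> \<le> \<parallel>V\<^sub>k - \<gamma> a\<^sub>k\<parallel>\<close>. Expanding the square, cocoercivity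
  makes \<open>\<parallel>V\<^sub>k\<parallel>\<^sup>2\<close> decrease by at least a fixed multiple of \<open>\<parallel>a\<^sub>k\<parallel>\<^sup>2\<close> in (a), so that \<open>\<Sum> \<parallel>a\<^sub>k\<parallel>\<^sup>2\<close> is
  finite, and contract by a fixed factor in (b).\<close>

text \<open>The hypothesis gives \<open>norm q * norm q \<le> inner p q\<close>; Cauchy-Schwarz
  bounds the right side, and a nonzero \<open>norm q\<close> cancels.\<close>

lemma norm_le_if_inner_diff_nonneg:
  fixes p q :: "'a::real_inner"
  assumes "inner (p - q) q \<ge> 0"
  shows "norm q \<le> norm p"
proof -
  have "norm q * norm q \<le> inner p q"
    using assms by (simp add: inner_diff_left flip: power2_norm_eq_inner power2_eq_square)
  also have "\<dots> \<le> norm p * norm q"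
    by (rule norm_cauchy_schwarz)
  finally show ?thesis
    by (cases "q = 0") auto
qed

text \<open>The decreases telescope, so the partial sums of \<open>d\<close> are bounded by
  \<open>e 0 / c\<close>; a summable sequence tends to zero.\<close>

lemma tendsto_zero_if_sufficient_decrease:
  fixes e d :: "nat \<Rightarrow> real"
  assumes "c > 0" and e: "\<And>k. 0 \<le> e k" and d: "\<And>k. 0 \<le> d k"
    and step: "\<And>k. e (Suc k) \<le> e k - c * d k"
  shows "d \<longlonglongrightarrow> 0"
proof -
  have "c * (\<Sum>k<n. d k) \<le> e 0 - e n" for n
  proof (induction n)
    case (Suc n)
    then show ?case using step[of n] by (simp add: algebra_simps)
  qed simp
  then have "(\<Sum>k<n. d k) \<le> e 0 / c" for n
    using e[of n] \<open>c > 0\<close> by (smt (verit) mult.commute pos_le_divide_eq)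
  then have "summable d"
    using d by (intro bounded_imp_summable[where B = "e 0 / c"])
      (simp_all flip: lessThan_Suc_atMost del: sum.lessThan_Suc)
  then show ?thesis
    by (rule summable_LIMSEQ_zero)
qed

lemma converges_linearly_if_power2_contraction:
  fixes z :: "nat \<Rightarrow> 'a::real_normed_vector"
  assumes "c < 1" and step: "\<And>k. (norm (z (Suc k) - l))\<^sup>2 \<le> c * (norm (z k - l))\<^sup>2"
  shows "converges_linearly z l"
proof -
  \<comment> \<open>The root turns a contraction of squares into one of norms. Since
    \<open>c\<close> may be negative, it is first replaced by \<open>max c 0\<close>, which is still
    below 1.\<close>
  define r where "r = sqrt (max c 0)"
  have r: "0 \<le> r" "r < 1" "c \<le> r\<^sup>2"
    using \<open>c < 1\<close> by (auto simp: r_def max_def)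
  have "norm (z (Suc k) - l) \<le> r * norm (z k - l)" for k
  proof (rule power2_le_imp_le)
    show "(norm (z (Suc k) - l))\<^sup>2 \<le> (r * norm (z k - l))\<^sup>2"
      using step[of k] mult_right_mono[OF r(3), of "(norm (z k - l))\<^sup>2"]
      by (simp add: power_mult_distrib)
  qed (use r in simp)
  then have "norm (z k - l) \<le> norm (z 0 - l) * r ^ k" for k
  proof (induction k)
    case (Suc k)
    then show ?case
      using order_trans[OF Suc.prems[of k] mult_left_mono[OF Suc.IH[OF Suc.prems] r(1)]]
      by (simp add: mult_ac)
  qed simp
  then show ?thesis
    unfolding converges_linearly_def using r by (metis norm_ge_zero)
qed

text \<open>The rate \<open>q\<close> is kept and the constant \<open>C\<close> becomes
  \<open>M * C\<close>. Taking an inverse map for \<open>f\<close> recovers the iterates from their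
  images.\<close>

lemma converges_linearly_lipschitz_image:
  assumes "converges_linearly z l" and "M-lipschitz_on D f" and "\<And>k. z k \<in> D" and "l \<in> D"
  shows "converges_linearly (\<lambda>k. f (z k)) (f l)"
proof -
  obtain C q where C: "C \<ge> 0" "0 \<le> q" "q < 1" "\<And>k. norm (z k - l) \<le> C * q ^ k"
    using assms(1) unfolding converges_linearly_def by blast
  have M: "M \<ge> 0"
    using assms(2) by (rule lipschitz_on_nonneg)
  have "norm (f (z k) - f l) \<le> (M * C) * q ^ k" for k
    using lipschitz_onD[OF assms(2,3,4), of k] mult_left_mono[OF C(4)[of k] M]
    by (simp add: dist_norm mult.assoc)
  then show ?thesis
    unfolding converges_linearly_def using M C by (meson mult_nonneg_nonneg)
qed

lemma op_of_in_op_ran: "f x \<in> op_ran (op_of f)"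
  by (auto simp: op_ran_def op_of_def)

text \<open>The fibre of \<open>f\<close> over \<open>f x\<close> always contains \<open>x\<close>,
  so if it is a singleton it is \<open>{x}\<close>.\<close>

lemma map_of_op_inv_op_of:
  assumes "single_valued_op_on (op_ran (op_of f)) (op_inv (op_of f))"
  shows "map_of_op (op_inv (op_of f)) (f x) = x"
proof -
  obtain y where "op_inv (op_of f) (f x) = {y}"
    using assms op_of_in_op_ran[of f x] unfolding single_valued_op_on_def by blast
  moreover have "x \<in> op_inv (op_of f) (f x)"
    by (simp add: op_inv_def op_of_def)
  ultimately show ?thesis
    by (simp add: map_of_op_def)
qed

lemma forward_backward_step:
  fixes A v :: "'a::real_inner \<Rightarrow> 'a"
  assumes "\<gamma> > 0" and mono: "monotone_pair B (op_of v)"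
    and zero: "z \<in> op_zeros (op_add (op_of A) B)"
    and step: "y \<in> op_inv (op_add (op_scale \<gamma> B) (op_of v)) (v x - \<gamma> *\<^sub>R A x)"
  shows "(norm (v y - v z))\<^sup>2
    \<le> (norm (v x - v z))\<^sup>2 - 2 * \<gamma> * inner (A x - A z) (v x - v z) + \<gamma>\<^sup>2 * (norm (A x - A z))\<^sup>2"
proof -
  obtain b where b: "b \<in> B y" "v x - \<gamma> *\<^sub>R A x = \<gamma> *\<^sub>R b + v y"
    using step by (auto simp: op_inv_def op_add_def op_scale_def op_of_def)
  \<comment> \<open>Since \<open>z\<close> is a zero, \<open>- A z\<close> is the element of
    \<open>B z\<close> to be paired with \<open>b\<close> in the monotonicity of \<open>B\<close>
    and \<open>v\<close>.\<close>
  have "- A z \<in> B z"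
    using zero by (auto simp: op_zeros_def op_add_def op_of_def) (metis minus_unique)
  then have "inner (b - - A z) (v y - v z) \<ge> 0"
    using mono b(1) unfolding monotone_pair_def op_of_def by blast
  then have "inner (\<gamma> *\<^sub>R (b + A z)) (v y - v z) \<ge> 0"
    using \<open>\<gamma> > 0\<close> by simp
  \<comment> \<open>Eliminating \<open>b\<close> through the inclusion for \<open>y\<close> leaves a
    difference whose subtrahend is \<open>v y - v z\<close> itself, as the norm comparison
    requires.\<close>
  moreover have "\<gamma> *\<^sub>R (b + A z) = ((v x - v z) - \<gamma> *\<^sub>R (A x - A z)) - (v y - v z)"
    using b(2) by (simp add: algebra_simps)
  ultimately have "norm (v y - v z) \<le> norm ((v x - v z) - \<gamma> *\<^sub>R (A x - A z))"
    by (intro norm_le_if_inner_diff_nonneg) simp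
  then have "(norm (v y - v z))\<^sup>2 \<le> (norm ((v x - v z) - \<gamma> *\<^sub>R (A x - A z)))\<^sup>2"
    by (simp add: power_mono)
  also have "\<dots> = (norm (v x - v z))\<^sup>2 - 2 * \<gamma> * inner (A x - A z) (v x - v z)
      + \<gamma>\<^sup>2 * (norm (A x - A z))\<^sup>2"
    using dot_norm_neg[of "v x - v z" "\<gamma> *\<^sub>R (A x - A z)"]
    by (simp add: power_mult_distrib inner_commute)
  finally show ?thesis .
qed

theorem theorem3p3:
  fixes A v :: "'a::{real_inner, complete_space} \<Rightarrow> 'a"
    and B :: "'a set_op"
    and \<gamma> :: real
    and xstar :: 'a
    and x :: "nat \<Rightarrow> 'a"
  assumes "op_zeros (op_add (op_of A) B) \<noteq> {}"
    and "monotone_pair (op_of A) (op_of v)"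
    and "monotone_pair B (op_of v)"
    and "\<gamma> > 0"
    and "op_ran (op_add (op_scale \<gamma> B) (op_of v)) = UNIV"
    and "xstar \<in> op_zeros (op_add (op_of A) B)"
    and "\<And>k. x (Suc k) \<in> op_inv (op_add (op_scale \<gamma> B) (op_of v)) (v (x k) - \<gamma> *\<^sub>R A (x k))"
  shows
    "(\<forall>\<alpha>>0. cocoercive_pair \<alpha> A v \<and> \<gamma> < 2 * \<alpha> \<longrightarrow>
        (\<lambda>k. A (x k)) \<longlonglongrightarrow> A xstar \<and>
        (single_valued_op_on (op_ran (op_of A)) (op_inv (op_of A)) \<and>
         continuous_on (op_ran (op_of A)) (map_of_op (op_inv (op_of A)))
           \<longrightarrow> x \<longlonglongrightarrow> xstar)) \<and>
     (\<forall>\<alpha>>0. \<forall>L>0. cocoercive_pair \<alpha> v A \<and> lipschitz_pair L A v \<and> \<gamma> < 2 * \<alpha> / L\<^sup>2 \<longrightarrow>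
        converges_linearly (\<lambda>k. v (x k)) (v xstar) \<and>
        (single_valued_op_on (op_ran (op_of v)) (op_inv (op_of v)) \<and>
         (\<exists>M. M-lipschitz_on (op_ran (op_of v)) (map_of_op (op_inv (op_of v))))
           \<longrightarrow> converges_linearly x xstar))"
proof (intro conjI allI impI)
  note step = forward_backward_step[OF assms(4,3,6,7)]
  {
    fix \<alpha> :: real
    assume "cocoercive_pair \<alpha> A v \<and> \<gamma> < 2 * \<alpha>"
    then have coc: "\<And>y z. inner (A y - A z) (v y - v z) \<ge> \<alpha> * (norm (A y - A z))\<^sup>2"
      and "\<gamma> < 2 * \<alpha>"
      by (auto simp: cocoercive_pair_def)
    have "(\<lambda>k. (norm (A (x k) - A xstar))\<^sup>2) \<longlonglongrightarrow> 0"
    proof (rule tendsto_zero_if_sufficient_decrease)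
      \<comment> \<open>Cocoercivity turns the cross term into at most -2 \<gamma> \<alpha> times
        the squared norm, while the quadratic term adds \<gamma> squared times it. The net decrease
        is positive because \<gamma> < 2 \<alpha>.\<close>
      show "\<gamma> * (2 * \<alpha> - \<gamma>) > 0"
        using \<open>\<gamma> > 0\<close> \<open>\<gamma> < 2 * \<alpha>\<close> by simp
      show "(norm (v (x (Suc k)) - v xstar))\<^sup>2
          \<le> (norm (v (x k) - v xstar))\<^sup>2 - \<gamma> * (2 * \<alpha> - \<gamma>) * (norm (A (x k) - A xstar))\<^sup>2" for k
        using step[of k] mult_left_mono[OF coc[of "x k" xstar], of "2 * \<gamma>"] \<open>\<gamma> > 0\<close>
        by (simp add: algebra_simps power2_eq_square)
    qed auto
    then show A_lim: "(\<lambda>k. A (x k)) \<longlonglongrightarrow> A xstar"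
      by (simp add: tendsto_norm_zero_iff flip: LIM_zero_iff[of _ "A xstar"])
    assume inv: "single_valued_op_on (op_ran (op_of A)) (op_inv (op_of A)) \<and>
      continuous_on (op_ran (op_of A)) (map_of_op (op_inv (op_of A)))"
    have "(\<lambda>k. map_of_op (op_inv (op_of A)) (A (x k)))
        \<longlonglongrightarrow> map_of_op (op_inv (op_of A)) (A xstar)"
      using inv by (intro continuous_on_tendsto_compose[OF _ A_lim]) (auto simp: op_of_in_op_ran)
    then show "x \<longlonglongrightarrow> xstar"
      using inv by (simp add: map_of_op_inv_op_of)
  }
  {
    fix \<alpha> L :: real
    assume "L > 0" and "cocoercive_pair \<alpha> v A \<and> lipschitz_pair L A v \<and> \<gamma> < 2 * \<alpha> / L\<^sup>2"
    then have coc: "\<And>y z. inner (A y - A z) (v y - v z) \<ge> \<alpha> * (norm (v y - v z))\<^sup>2"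
      and lip: "\<And>y z. norm (A y - A z) \<le> L * norm (v y - v z)"
      and "\<gamma> * L\<^sup>2 < 2 * \<alpha>"
      by (auto simp: cocoercive_pair_def lipschitz_pair_def inner_commute pos_less_divide_eq)
    show v_lim: "converges_linearly (\<lambda>k. v (x k)) (v xstar)"
    proof (rule converges_linearly_if_power2_contraction)
      \<comment> \<open>Here cocoercivity bounds the cross term by the squared norm of the
        \<open>v\<close> difference, and the Lipschitz bound expresses the quadratic term through
        that norm too, so all terms merge into one factor.\<close>
      show "1 - \<gamma> * (2 * \<alpha> - \<gamma> * L\<^sup>2) < 1"
        using \<open>\<gamma> > 0\<close> \<open>\<gamma> * L\<^sup>2 < 2 * \<alpha>\<close> by simp
      fix k
      have "(norm (A (x k) - A xstar))\<^sup>2 \<le> L\<^sup>2 * (norm (v (x k) - v xstar))\<^sup>2"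
        using power_mono[OF lip norm_ge_zero, of "x k" xstar 2] by (simp add: power_mult_distrib)
      then have "(norm (v (x k) - v xstar))\<^sup>2 - 2 * \<gamma> * inner (A (x k) - A xstar) (v (x k) - v xstar)
            + \<gamma>\<^sup>2 * (norm (A (x k) - A xstar))\<^sup>2
          \<le> (norm (v (x k) - v xstar))\<^sup>2 - 2 * \<gamma> * (\<alpha> * (norm (v (x k) - v xstar))\<^sup>2)
            + \<gamma>\<^sup>2 * (L\<^sup>2 * (norm (v (x k) - v xstar))\<^sup>2)"
        using \<open>\<gamma> > 0\<close> by (intro add_mono diff_mono mult_left_mono coc) auto
      also have "\<dots> = (1 - \<gamma> * (2 * \<alpha> - \<gamma> * L\<^sup>2)) * (norm (v (x k) - v xstar))\<^sup>2"
        by (simp add: algebra_simps power2_eq_square)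
      finally show "(norm (v (x (Suc k)) - v xstar))\<^sup>2
          \<le> (1 - \<gamma> * (2 * \<alpha> - \<gamma> * L\<^sup>2)) * (norm (v (x k) - v xstar))\<^sup>2"
        using step[of k] by linarith
    qed
    assume inv: "single_valued_op_on (op_ran (op_of v)) (op_inv (op_of v)) \<and>
      (\<exists>M. M-lipschitz_on (op_ran (op_of v)) (map_of_op (op_inv (op_of v))))"
    then obtain M where M: "M-lipschitz_on (op_ran (op_of v)) (map_of_op (op_inv (op_of v)))"
      by blast
    \<comment> \<open>All \<open>v (x k)\<close> and \<open>v xstar\<close> lie in the range of
      \<open>v\<close>, where the inverse is Lipschitz and undoes \<open>v\<close>.\<close>
    have "converges_linearly (\<lambda>k. map_of_op (op_inv (op_of v)) (v (x k)))
        (map_of_op (op_inv (op_of v)) (v xstar))"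
      by (intro converges_linearly_lipschitz_image[OF v_lim M] op_of_in_op_ran)
    then show "converges_linearly x xstar"
      using inv by (simp add: map_of_op_inv_op_of)
  }
qed

end
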